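(* Let $G=(V,E\cup A)$ be a mixed graph that admits a mixed edge cover. For $F\subseteq E\cup A$ define the mix-size $\|F\|:=|F\cap E|+\tfrac12|F\cap A|$. Let $\nu(G):=\max\{\|F\|: F \text{ is a matching forest in } G\}$ and $\rho(G):=\min\{\|H\|: H \text{ is a mixed edge cover in } G\}$. Then $\nu(G)+\rho(G)=|V|$.
   Context: A mixed graph $G=(V,E\cup A)$ has a finite vertex set $V$, a set $E$ of undirected edges and a set $A$ of directed arcs; no loops, parallel edges/arcs allowed. Each arc has one head; both endpoints of an edge are regarded as its heads; $v$ is covered by $e$ if $v$ is a head of $e$. A matching forest is a subset $F\subseteq E\cup A$ whose underlying undirected graph has no cycle and in which every vertex is covered at most once. A mixed edge cover is a subset $F\subseteq E\cup A$ such that for every $v\in V$ there is a directed path (possibly of length $0$) using only arcs of $F\cap A$ from an endpoint of some edge of $F\cap E$ to $v$. *)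

theory Defs
  imports Complex_Main "Graph_Theory.Arc_Walk"
begin

text \<open>
  Edges and arcs are named objects of a common type, so parallel edges, parallel arcs, opposite
  arcs, and edges parallel to arcs are all possible. The field \<open>uends\<close> is only meaningful
  on undirected edges, and \<open>tail\<close> and \<open>head\<close> only on arcs.
\<close>

record ('v, 'e) mixed_graph = "('v, 'e) pre_digraph" +
  edges :: "'e set"
  uends :: "'e \<Rightarrow> 'v set"

locale mixed_graph =
  fixes G :: "('v, 'e) mixed_graph"
  assumes finite_verts: "finite (verts G)"
    and finite_edges: "finite (edges G)"
    and finite_arcs: "finite (arcs G)"
    and edges_arcs_disjoint: "edges G \<inter> arcs G = {}"
    and uends_in_verts: "e \<in> edges G \<Longrightarrow> uends G e \<subseteq> verts G"
    and edge_no_loop: "e \<in> edges G \<Longrightarrow> card (uends G e) = 2"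
    and tail_in_verts: "a \<in> arcs G \<Longrightarrow> tail G a \<in> verts G"
    and head_in_verts: "a \<in> arcs G \<Longrightarrow> head G a \<in> verts G"
    and arc_no_loop: "a \<in> arcs G \<Longrightarrow> tail G a \<noteq> head G a"

definition endpoints :: "('v, 'e) mixed_graph \<Rightarrow> 'e \<Rightarrow> 'v set" where
  "endpoints G e = (if e \<in> edges G then uends G e else {tail G e, head G e})"

definition heads :: "('v, 'e) mixed_graph \<Rightarrow> 'e \<Rightarrow> 'v set" where
  "heads G e = (if e \<in> edges G then uends G e else {head G e})"

definition covered_by :: "('v, 'e) mixed_graph \<Rightarrow> 'v \<Rightarrow> 'e \<Rightarrow> bool" where
  "covered_by G v e \<longleftrightarrow> v \<in> heads G e"

text \<open>
  A cycle of the underlying undirected multigraph of \<open>F\<close>, with vertices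
  \<open>vs ! 0, vs ! 1, \<dots>\<close>, where \<open>es ! i\<close> joins \<open>vs ! i\<close> to its cyclic successor.
  Two parallel elements of \<open>F\<close> form a cycle of length 2.
\<close>

definition underlying_cycle ::
  "('v, 'e) mixed_graph \<Rightarrow> 'e set \<Rightarrow> 'v list \<Rightarrow> 'e list \<Rightarrow> bool" where
  "underlying_cycle G F vs es \<longleftrightarrow>
     es \<noteq> [] \<and> length vs = length es \<and> distinct vs \<and> distinct es \<and> set es \<subseteq> F \<and>
     (\<forall>i < length es. endpoints G (es ! i) = {vs ! i, vs ! (Suc i mod length es)})"

definition matching_forest :: "('v, 'e) mixed_graph \<Rightarrow> 'e set \<Rightarrow> bool" where
  "matching_forest G F \<longleftrightarrow>
     F \<subseteq> edges G \<union> arcs G \<and>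
     (\<nexists>vs es. underlying_cycle G F vs es) \<and>
     (\<forall>v \<in> verts G. card {e \<in> F. covered_by G v e} \<le> 1)"

definition arc_subgraph :: "('v, 'e) mixed_graph \<Rightarrow> 'e set \<Rightarrow> ('v, 'e) pre_digraph" where
  "arc_subgraph G F =
     \<lparr>verts = verts G, arcs = F \<inter> arcs G, tail = tail G, head = head G\<rparr>"

definition mixed_edge_cover :: "('v, 'e) mixed_graph \<Rightarrow> 'e set \<Rightarrow> bool" where
  "mixed_edge_cover G F \<longleftrightarrow>
     F \<subseteq> edges G \<union> arcs G \<and>
     (\<forall>v \<in> verts G. \<exists>e \<in> F \<inter> edges G. \<exists>u \<in> endpoints G e. \<exists>p.
        pre_digraph.apath (arc_subgraph G F) u p v)"

definition mix_size :: "('v, 'e) mixed_graph \<Rightarrow> 'e set \<Rightarrow> real" where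
  "mix_size G F = real (card (F \<inter> edges G)) + 1 / 2 * real (card (F \<inter> arcs G))"

text \<open>
  In a mixed graph, \<open>Max\<close> is taken over a finite nonempty set (the empty set is a matching
  forest); \<open>Min\<close> is taken over a finite set that is nonempty iff a mixed edge cover exists.
\<close>

definition nu :: "('v, 'e) mixed_graph \<Rightarrow> real" where
  "nu G = Max {mix_size G F | F. matching_forest G F}"

definition rho :: "('v, 'e) mixed_graph \<Rightarrow> real" where
  "rho G = Min {mix_size G H | H. mixed_edge_cover G H}"

end

theory Submission
  imports Defs "HOL-Library.Disjoint_Sets"
begin

text \<open>
  A matching forest of mix-size \<open>m\<close> covers exactly \<open>2 * m\<close> vertices, so in both
  directions one counts uncovered vertices.

  From a mixed edge cover \<open>H\<close> keep an inclusion-maximal matching \<open>N\<close> of the edges of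
  \<open>H\<close> and, for every vertex not on an edge of \<open>H\<close>, one entering arc of \<open>H\<close> on a
  shortest path from the edges. An element of such a set covers its end of highest distance, so an
  underlying cycle would cover its vertex of highest distance twice.

  Conversely, start with the edges \<open>M\<close> of a matching forest. As long as some vertex cannot be
  reached from \<open>M\<close>, tracing the forest backwards yields an unreachable uncovered vertex
  \<open>u\<close>; add an edge from which \<open>u\<close> is reachable. Each step increases
  \<open>2 * card M - card (V M)\<close> by at most 1 and reaches a further uncovered vertex, where
  \<open>V M\<close> is the set of vertices on edges in \<open>M\<close>. In the end, every vertex outside
  \<open>V M\<close> is paid for by one arc.
\<close>

section \<open>Vertices on edges and reachability along arcs\<close>

definition edge_verts :: "('v, 'e) mixed_graph \<Rightarrow> 'e set \<Rightarrow> 'v set" where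
  "edge_verts G M = (\<Union>e\<in>M. uends G e)"

definition arc_rel :: "('v, 'e) mixed_graph \<Rightarrow> 'e set \<Rightarrow> 'v rel" where
  "arc_rel G D = (\<lambda>a. (tail G a, head G a)) ` D"

definition uncovered :: "('v, 'e) mixed_graph \<Rightarrow> 'e set \<Rightarrow> 'v set" where
  "uncovered G F = {v \<in> verts G. \<forall>e\<in>F. \<not> covered_by G v e}"

text \<open>Every arc of \<open>G\<close> may be used here, because the arcs of the new cover are
  selected only after its edges are fixed.\<close>

definition reachable_from :: "('v, 'e) mixed_graph \<Rightarrow> 'e set \<Rightarrow> 'v set" where
  "reachable_from G M = (arc_rel G (arcs G))\<^sup>* `` edge_verts G M"

context mixed_graph
begin

lemma finite_elements: "finite (edges G \<union> arcs G)"
  using finite_edges finite_arcs by simp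

lemma arc_not_edge: "a \<in> arcs G \<Longrightarrow> a \<notin> edges G"
  using edges_arcs_disjoint by blast

lemma edge_verts_subset: "M \<subseteq> edges G \<Longrightarrow> edge_verts G M \<subseteq> verts G"
  using uends_in_verts by (auto simp: edge_verts_def)

lemma arc_subgraph_awalk_iff_rtrancl:
  assumes "u \<in> verts G"
  shows "(\<exists>p. pre_digraph.awalk (arc_subgraph G F) u p v) \<longleftrightarrow> (u, v) \<in> (arc_rel G (F \<inter> arcs G))\<^sup>*"
proof -
  interpret D: wf_digraph "arc_subgraph G F"
    by unfold_locales (auto simp: arc_subgraph_def tail_in_verts head_in_verts)
  have *: "arcs (arc_subgraph G F) = F \<inter> arcs G" "tail (arc_subgraph G F) = tail G"
    "head (arc_subgraph G F) = head G" "verts (arc_subgraph G F) = verts G"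
    by (auto simp: arc_subgraph_def)
  have "D.awalk u p v \<Longrightarrow> (u, v) \<in> (arc_rel G (F \<inter> arcs G))\<^sup>*" for p
  proof (induction p arbitrary: u)
    case Nil
    then show ?case by (simp add: D.awalk_Nil_iff)
  next
    case (Cons a p)
    then have "a \<in> F \<inter> arcs G" "tail G a = u" "D.awalk (head G a) p v"
      by (auto simp: D.awalk_Cons_iff *)
    moreover from this have "(u, head G a) \<in> arc_rel G (F \<inter> arcs G)"
      by (force simp: arc_rel_def)
    ultimately show ?case using Cons.IH by (meson converse_rtrancl_into_rtrancl)
  qed
  moreover have "\<exists>p. D.awalk u p v" if "(u, v) \<in> (arc_rel G (F \<inter> arcs G))\<^sup>*"
    using that
  proof (induction rule: rtrancl_induct)
    case base
    \<comment> \<open>The empty walk exists only at a vertex of the digraph, hence the hypothesis on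
      \<open>u\<close>.\<close>
    show ?case using assms by (intro exI[of _ "[]"]) (simp add: D.awalk_Nil_iff *)
  next
    case (step y z)
    then obtain a p where "D.awalk u p y" "a \<in> F \<inter> arcs G" "tail G a = y" "head G a = z"
      by (auto simp: arc_rel_def)
    then have "D.awalk u (p @ [a]) z"
      by (auto simp: D.awalk_append_iff D.awalk_Cons_iff D.awalk_Nil_iff * head_in_verts)
    then show ?case by blast
  qed
  ultimately show ?thesis by blast
qed

text \<open>Walks shorten to paths with the same ends, so directed paths can be traded for the
  closure of \<open>arc_rel\<close>. The starting point is a vertex because it lies on an
  edge.\<close>

lemma mixed_edge_cover_iff:
  "mixed_edge_cover G H \<longleftrightarrow> H \<subseteq> edges G \<union> arcs G \<and>
     (\<forall>v\<in>verts G. \<exists>u\<in>edge_verts G (H \<inter> edges G). (u, v) \<in> (arc_rel G (H \<inter> arcs G))\<^sup>*)"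
proof -
  interpret D: wf_digraph "arc_subgraph G H"
    by unfold_locales (auto simp: arc_subgraph_def tail_in_verts head_in_verts)
  have apath: "(\<exists>p. D.apath u p v) \<longleftrightarrow> (\<exists>p. D.awalk u p v)" for u v
    by (meson D.apath_awalk_to_apath D.awalkI_apath)
  have eq: "(\<exists>p. D.apath u p v) \<longleftrightarrow> (u, v) \<in> (arc_rel G (H \<inter> arcs G))\<^sup>*"
    if "e \<in> H \<inter> edges G" "u \<in> endpoints G e" for e u v
    unfolding apath
    by (rule arc_subgraph_awalk_iff_rtrancl)
       (use that uends_in_verts in \<open>auto simp: endpoints_def\<close>)
  have "(\<exists>e\<in>H \<inter> edges G. \<exists>u\<in>endpoints G e. \<exists>p. D.apath u p v) \<longleftrightarrow>
    (\<exists>u\<in>edge_verts G (H \<inter> edges G). (u, v) \<in> (arc_rel G (H \<inter> arcs G))\<^sup>*)" for v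
    using eq by (fastforce simp: edge_verts_def endpoints_def)
  then show ?thesis by (simp add: mixed_edge_cover_def)
qed

section \<open>Distances from the edges, and cycles\<close>

text \<open>Here \<open>rank\<close> is the distance from \<open>S\<close> along \<open>D\<close>,
  and \<open>b v\<close> is the last arc of a shortest path to \<open>v\<close>, so its tail is
  nearer to \<open>S\<close>.\<close>

lemma ranked_branching:
  assumes "\<And>v. v \<in> verts G \<Longrightarrow> \<exists>u\<in>S. (u, v) \<in> (arc_rel G D)\<^sup>*"
  obtains b and rank :: "'v \<Rightarrow> nat" where
    "\<forall>v\<in>verts G - S. b v \<in> D \<and> head G (b v) = v \<and> rank (tail G (b v)) < rank v"
proof -
  let ?P = "\<lambda>v n. \<exists>u\<in>S. (u, v) \<in> arc_rel G D ^^ n"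
  define rank where "rank v = (LEAST n. ?P v n)" for v
  have "\<exists>a. a \<in> D \<and> head G a = v \<and> rank (tail G a) < rank v" if v: "v \<in> verts G - S" for v
  proof -
    have "\<exists>n. ?P v n" using assms[of v] v by (auto simp: rtrancl_is_UN_relpow)
    then have "?P v (rank v)" unfolding rank_def by (rule LeastI_ex)
    then obtain u where u: "u \<in> S" "(u, v) \<in> arc_rel G D ^^ rank v" by blast
    \<comment> \<open>Distance 0 would put \<open>v\<close> into \<open>S\<close>.\<close>
    obtain m where m: "rank v = Suc m"
      using u v by (cases "rank v") auto
    with u obtain a where a: "a \<in> D" "head G a = v" "(u, tail G a) \<in> arc_rel G D ^^ m"
      by (auto simp: arc_rel_def)
    then have "rank (tail G a) \<le> m"
      unfolding rank_def using u(1) by (intro Least_le) blast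
    then show ?thesis using a m by auto
  qed
  then show ?thesis using that by metis
qed

lemma no_underlying_cycle_if_ranked:
  fixes rank :: "'v \<Rightarrow> nat"
  assumes F: "F \<subseteq> edges G \<union> arcs G"
    and cov: "\<And>v. v \<in> verts G \<Longrightarrow> card {e \<in> F. covered_by G v e} \<le> 1"
    and rank: "\<And>a. a \<in> F \<inter> arcs G \<Longrightarrow> rank (tail G a) < rank (head G a)"
  shows "\<not> underlying_cycle G F vs es"
proof
  assume cyc: "underlying_cycle G F vs es"
  let ?n = "length es"
  have n: "?n > 0" "length vs = ?n" "distinct es" "set es \<subseteq> F"
    and ends: "\<And>i. i < ?n \<Longrightarrow> endpoints G (es ! i) = {vs ! i, vs ! (Suc i mod ?n)}"
    using cyc by (auto simp: underlying_cycle_def)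
  have two: "card (endpoints G e) = 2" "endpoints G e \<subseteq> verts G" if "e \<in> F" for e
    using that F edge_no_loop arc_no_loop uends_in_verts tail_in_verts head_in_verts
    by (auto simp: endpoints_def)
  \<comment> \<open>A cycle of length 1 would need a loop. From length 2 on, every vertex of the
    cycle lies on two different elements.\<close>
  have "es ! 0 \<in> F" using n(1,4) nth_mem by blast
  then have "?n \<noteq> 1"
    using ends[of 0] two(1)[of "es ! 0"] n(1) by auto
  then have n2: "?n \<ge> 2" using n by linarith
  obtain i where i: "i < ?n" and max: "\<And>j. j < ?n \<Longrightarrow> rank (vs ! j) \<le> rank (vs ! i)"
    using arg_max_natI[of "\<lambda>i. i < ?n" 0 "\<lambda>i. rank (vs ! i)" "Suc (Max ((\<lambda>i. rank (vs ! i)) ` {..<?n}))"]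
      arg_max_nat_le[of "\<lambda>i. i < ?n" _ "\<lambda>i. rank (vs ! i)" "Suc (Max ((\<lambda>i. rank (vs ! i)) ` {..<?n}))"] n(1)
    by (metis (mono_tags, lifting) Max_ge finite_imageI finite_lessThan image_eqI le_imp_less_Suc lessThan_iff)
  let ?v = "vs ! i"
  \<comment> \<open>An edge covers both its ends. If \<open>?v\<close> were the tail of an arc of
    the cycle, the head would have higher rank than the maximum.\<close>
  have covers: "covered_by G ?v (es ! j)" if j: "j < ?n" "?v \<in> endpoints G (es ! j)" for j
  proof (cases "es ! j \<in> edges G")
    case True
    then show ?thesis using j by (simp add: covered_by_def heads_def endpoints_def)
  next
    case False
    then have arc: "es ! j \<in> F \<inter> arcs G" using F n j nth_mem by blast
    have "Suc j mod ?n < ?n" using n by simp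
    then have "rank (head G (es ! j)) \<le> rank ?v"
      using ends[OF j(1)] False max[OF j(1)] max[of "Suc j mod ?n"]
      by (auto simp: endpoints_def doubleton_eq_iff)
    then have "?v \<noteq> tail G (es ! j)" using rank[OF arc] by auto
    then show ?thesis using j False by (auto simp: covered_by_def heads_def endpoints_def)
  qed
  \<comment> \<open>\<open>es ! j\<close> is the cyclic predecessor of \<open>es ! i\<close>,
    wrapping round at \<open>i = 0\<close>; both have \<open>?v\<close> as an end.\<close>
  define j where "j = (if i = 0 then ?n - 1 else i - 1)"
  have j: "j < ?n" "j \<noteq> i" "Suc j mod ?n = i" using i n2 by (auto simp: j_def)
  have "es ! i \<noteq> es ! j" using j i n(3) by (simp add: nth_eq_iff_index_eq)
  moreover have "{es ! i, es ! j} \<subseteq> {e \<in> F. covered_by G ?v e}"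
    using covers[OF i] covers[OF j(1)] ends[OF i] ends[OF j(1)] j i n(4) by auto
  moreover have "finite {e \<in> F. covered_by G ?v e}"
    using F finite_elements finite_subset by fastforce
  ultimately have "2 \<le> card {e \<in> F. covered_by G ?v e}"
    by (metis card_2_iff card_mono)
  moreover have "?v \<in> verts G" using two(2)[of "es ! i"] ends[OF i] nth_mem[OF i] n(4) by blast
  ultimately show False using cov[of ?v] by simp
qed

text \<open>Choosing an entering arc \<open>a w\<close> for each \<open>w\<close> and passing to its
  tail defines a self-map \<open>p\<close> of the finite set \<open>W\<close>. Its orbits are
  eventually periodic, and a period, traversed against the arcs, is the desired cycle.\<close>

lemma underlying_cycle_if_all_entered:
  assumes W: "W \<noteq> {}" "finite W"
    and entered: "\<And>w. w \<in> W \<Longrightarrow> \<exists>a\<in>F \<inter> arcs G. head G a = w \<and> tail G a \<in> W"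
  shows "\<exists>vs es. underlying_cycle G F vs es"
proof -
  obtain a where a: "\<And>w. w \<in> W \<Longrightarrow> a w \<in> F \<inter> arcs G \<and> head G (a w) = w \<and> tail G (a w) \<in> W"
    using entered by metis
  define p where "p w = tail G (a w)" for w
  have p_in: "(p ^^ n) w \<in> W" if "w \<in> W" for n w
    using that a by (induction n) (auto simp: p_def)
  have cancel: "(p ^^ (j - i)) ((p ^^ i) w) = (p ^^ i) w" if "i < j" "(p ^^ i) w = (p ^^ j) w" for i j w
    using that by (metis add.commute add_diff_inverse_nat comp_apply funpow_add not_less_iff_gr_or_eq)
  obtain w where w: "w \<in> W" using W by blast
  have "\<not> inj (\<lambda>n. (p ^^ n) w)"
    using W(2) p_in[OF w] by (metis finite_imageD finite_subset image_subsetI infinite_UNIV_nat)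
  then obtain i j where "i < j" "(p ^^ i) w = (p ^^ j) w"
    unfolding inj_def by (metis linorder_neqE_nat)
  then have ex: "\<exists>n. 0 < n \<and> (\<exists>x\<in>W. (p ^^ n) x = x)"
    using cancel p_in[OF w] by (metis zero_less_diff)
  \<comment> \<open>The period is minimal over all points of \<open>W\<close> at once: a repetition
    among the first \<open>n\<close> iterates of \<open>x\<close> would give a point of
    \<open>W\<close> with a shorter period.\<close>
  define n where "n = (LEAST n. 0 < n \<and> (\<exists>x\<in>W. (p ^^ n) x = x))"
  have "0 < n \<and> (\<exists>x\<in>W. (p ^^ n) x = x)" unfolding n_def using ex by (rule LeastI_ex)
  then obtain x where n: "0 < n" and x: "x \<in> W" "(p ^^ n) x = x" by blast
  have min: "n \<le> m" if "0 < m" "y \<in> W" "(p ^^ m) y = y" for m y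
    unfolding n_def using that by (intro Least_le) blast
  have noeq: "(p ^^ i) x \<noteq> (p ^^ j) x" if "i < j" "j < n" for i j
    using min[OF _ p_in[OF x(1)] cancel[OF that(1)]] that by force
  have inj: "inj_on (\<lambda>i. (p ^^ i) x) {..<n}"
    by (rule inj_onI) (metis lessThan_iff linorder_neqE_nat noeq)
  \<comment> \<open>The arc \<open>a w\<close> determines \<open>w\<close> as its head, so distinct
    vertices give distinct arcs.\<close>
  have "inj_on a W" using a by (metis inj_onI)
  then have inj2: "inj_on (\<lambda>i. a ((p ^^ i) x)) {..<n}"
    using inj p_in[OF x(1)] by (auto simp: inj_on_def)
  let ?vs = "map (\<lambda>i. (p ^^ i) x) [0..<n]" and ?es = "map (\<lambda>i. a ((p ^^ i) x)) [0..<n]"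
  have "endpoints G (?es ! i) = {?vs ! i, ?vs ! (Suc i mod length ?es)}" if i: "i < n" for i
  proof -
    \<comment> \<open>At the last index the successor wraps to 0, which agrees because
      \<open>(p ^^ n) x = x\<close>.\<close>
    have "?vs ! (Suc i mod length ?es) = p ((p ^^ i) x)"
      using i x(2) by (cases "Suc i = n") auto
    moreover have "endpoints G (a ((p ^^ i) x)) = {(p ^^ i) x, p ((p ^^ i) x)}"
      using a[OF p_in[OF x(1)], of i] arc_not_edge by (auto simp: endpoints_def p_def)
    ultimately show ?thesis using i by simp
  qed
  moreover have "set ?es \<subseteq> F" using a p_in[OF x(1)] by auto
  ultimately have "underlying_cycle G F ?vs ?es"
    using n inj inj2 by (simp add: underlying_cycle_def distinct_map lessThan_atLeast0)
  then show ?thesis by blast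
qed

section \<open>Matchings inside a set of edges\<close>

lemma card_edge_verts_matching:
  assumes N: "N \<subseteq> edges G" and disj: "disjoint_family_on (uends G) N"
  shows "card (edge_verts G N) = 2 * card N"
proof -
  have fin: "finite N" using N finite_edges finite_subset by blast
  have "card (edge_verts G N) = (\<Sum>e\<in>N. card (uends G e))"
    unfolding edge_verts_def
    by (intro card_UN_disjoint fin)
       (use disj N uends_in_verts finite_subset[OF _ finite_verts] in
         \<open>auto simp: disjoint_family_on_def\<close>)
  also have "\<dots> = (\<Sum>e\<in>N. 2)" using N edge_no_loop by (intro sum.cong) auto
  finally show ?thesis by simp
qed

text \<open>For an inclusion-maximal matching \<open>N\<close> in \<open>M\<close>, let every vertex
  of \<open>M\<close> missed by \<open>N\<close> pick an edge of \<open>M - N\<close> through it.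
  Two missed vertices never pick the same edge, as that edge could be added to \<open>N\<close>. So
  at most \<open>card M - card N\<close> vertices are missed, and \<open>N\<close> has
  \<open>2 * card N\<close>.\<close>

lemma large_matching_exists:
  assumes M: "M \<subseteq> edges G"
  obtains N where "N \<subseteq> M" "disjoint_family_on (uends G) N"
    "card (edge_verts G M) \<le> card M + card N"
proof -
  have finM: "finite M" using M finite_edges finite_subset by blast
  let ?Ns = "{N. N \<subseteq> M \<and> disjoint_family_on (uends G) N}"
  have "finite ?Ns" using finM by auto
  moreover have "{} \<in> ?Ns" by (auto simp: disjoint_family_on_def)
  ultimately obtain N where N: "N \<in> ?Ns" and max: "\<And>N'. N' \<in> ?Ns \<Longrightarrow> N \<subseteq> N' \<Longrightarrow> N = N'"
    by (metis (no_types, lifting) empty_iff finite_has_maximal)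
  let ?X = "edge_verts G M - edge_verts G N"
  have finV: "finite (edge_verts G M)"
    using edge_verts_subset[OF M] finite_verts finite_subset by blast
  obtain f where f: "\<And>x. x \<in> ?X \<Longrightarrow> f x \<in> M \<and> x \<in> uends G (f x)"
    unfolding edge_verts_def by (metis DiffD1 UN_E)
  have "inj_on f ?X"
  proof (rule inj_onI, rule ccontr)
    fix x y assume xy: "x \<in> ?X" "y \<in> ?X" "f x = f y" "x \<noteq> y"
    let ?e = "f x"
    have e: "?e \<in> M" "{x, y} \<subseteq> uends G ?e" using f[OF xy(1)] f[OF xy(2)] xy(3) by auto
    have "card {x, y} = card (uends G ?e)" using xy e M edge_no_loop by (simp add: subset_iff)
    then have ends: "uends G ?e = {x, y}"
      by (metis e card_subset_eq card.infinite card_2_iff xy(4) zero_neq_numeral)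
    then have "uends G ?e \<inter> uends G e' = {}" if "e' \<in> N" for e'
      using xy that by (auto simp: edge_verts_def)
    then have "insert ?e N \<in> ?Ns"
      using N e by (auto simp: disjoint_family_on_def)
    then have "?e \<in> N" using max by blast
    then show False using xy ends by (auto simp: edge_verts_def)
  qed
  moreover have "f ` ?X \<subseteq> M - N" using f by (auto simp: edge_verts_def)
  ultimately have "card ?X \<le> card (M - N)"
    using finM by (meson card_inj_on_le finite_Diff)
  moreover have "edge_verts G N \<subseteq> edge_verts G M" using N by (auto simp: edge_verts_def)
  moreover have "card (edge_verts G N) = 2 * card N"
    using N M by (intro card_edge_verts_matching) auto
  moreover have "card (M - N) = card M - card N"
    using N finM by (auto intro: card_Diff_subset finite_subset)
  ultimately have "card (edge_verts G M) \<le> card M + card N"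
    using finV finM N card_mono[OF finM, of N] card_mono[OF finV, of "edge_verts G N"]
    by (simp add: card_Diff_subset finite_subset)
  then show ?thesis using N that by blast
qed

lemma mix_size_union:
  assumes "M \<subseteq> edges G" "B \<subseteq> arcs G"
  shows "mix_size G (M \<union> B) = card M + card B / 2"
proof -
  have "(M \<union> B) \<inter> edges G = M" "(M \<union> B) \<inter> arcs G = B"
    using assms edges_arcs_disjoint by auto
  then show ?thesis by (simp add: mix_size_def)
qed

section \<open>From mixed edge covers to matching forests\<close>

lemma matching_forest_of_mixed_edge_cover:
  assumes "mixed_edge_cover G H"
  shows "\<exists>F. matching_forest G F \<and> card (verts G) \<le> mix_size G F + mix_size G H"
proof -
  define M where "M = H \<inter> edges G"
  define S where "S = edge_verts G M"
  let ?D = "H \<inter> arcs G"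
  have M: "M \<subseteq> edges G" by (simp add: M_def)
  have S: "S \<subseteq> verts G" using edge_verts_subset[OF M] by (simp add: S_def)
  have "\<And>v. v \<in> verts G \<Longrightarrow> \<exists>u\<in>S. (u, v) \<in> (arc_rel G ?D)\<^sup>*"
    using assms by (auto simp: mixed_edge_cover_iff S_def M_def)
  then obtain b and rank :: "'v \<Rightarrow> nat" where
    b: "\<forall>v\<in>verts G - S. b v \<in> ?D \<and> head G (b v) = v \<and> rank (tail G (b v)) < rank v"
    by (rule ranked_branching)
  define B where "B = b ` (verts G - S)"
  obtain N where N: "N \<subseteq> M" "disjoint_family_on (uends G) N" "card S \<le> card M + card N"
    using large_matching_exists[OF M] unfolding S_def by metis
  have B: "B \<subseteq> ?D" using b by (auto simp: B_def)
  have "inj_on b (verts G - S)" using b by (metis inj_onI)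
  then have cardB: "card B = card (verts G) - card S"
    using S finite_verts by (simp add: B_def card_image card_Diff_subset finite_subset)
  let ?F = "N \<union> B"
  have F: "?F \<subseteq> edges G \<union> arcs G" using N(1) M B by blast
  \<comment> \<open>A vertex in \<open>S\<close> can be covered only by edges of \<open>N\<close>,
    which is a matching; a vertex \<open>v\<close> outside \<open>S\<close> can be covered only by
    \<open>b v\<close>.\<close>
  have cov: "card {e \<in> ?F. covered_by G v e} \<le> 1" for v
  proof -
    have edge: "e \<in> N \<and> v \<in> uends G e \<and> v \<in> S"
      if "e \<in> ?F" "covered_by G v e" "e \<in> edges G" for e
      using that B N(1) arc_not_edge by (auto simp: covered_by_def heads_def S_def edge_verts_def)
    have arc: "v \<notin> S \<and> e = b v" if "e \<in> ?F" "covered_by G v e" "e \<notin> edges G" for e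
      using that N(1) M b by (auto simp: covered_by_def heads_def B_def)
    have "e = e'" if "e \<in> {e \<in> ?F. covered_by G v e}" "e' \<in> {e \<in> ?F. covered_by G v e}" for e e'
      using that edge[of e] edge[of e'] arc[of e] arc[of e'] N(2)
      unfolding disjoint_family_on_def by blast
    moreover have "finite {e \<in> ?F. covered_by G v e}"
      using F finite_elements finite_subset by fastforce
    ultimately show ?thesis by (simp add: card_le_Suc0_iff_eq)
  qed
  have "rank (tail G a) < rank (head G a)" if "a \<in> ?F \<inter> arcs G" for a
  proof -
    have "a \<in> B" using that N(1) M arc_not_edge by blast
    then show ?thesis using b by (auto simp: B_def)
  qed
  then have "matching_forest G ?F"
    using F cov no_underlying_cycle_if_ranked[OF F, of rank] by (auto simp: matching_forest_def)
  \<comment> \<open>As \<open>card B\<close> is at most \<open>card ?D\<close>, the sum is at least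
    \<open>card N + card M + card B\<close>, hence at least \<open>card S + card B\<close>, the
    number of vertices.\<close>
  moreover have "card (verts G) \<le> mix_size G ?F + mix_size G H"
  proof -
    have "card B \<le> card ?D" using B finite_arcs by (intro card_mono) auto
    moreover have "mix_size G ?F = card N + card B / 2"
      using N(1) M B by (intro mix_size_union) auto
    moreover have "mix_size G H = card M + card ?D / 2" by (simp add: mix_size_def M_def)
    moreover have "card S \<le> card (verts G)" using S finite_verts by (simp add: card_mono)
    ultimately show ?thesis using cardB N(3) by (simp add: field_simps of_nat_diff)
  qed
  ultimately show ?thesis by blast
qed

section \<open>From matching forests to mixed edge covers\<close>

text \<open>Double counting of pairs of a vertex and an element covering it: an edge has two heads,
  an arc has one, and each vertex occurs in at most one pair.\<close>

lemma card_uncovered: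
  assumes "matching_forest G F"
  shows "card (uncovered G F) + 2 * mix_size G F = card (verts G)"
proof -
  let ?C = "\<lambda>v. {e \<in> F. covered_by G v e}"
  have F: "F \<subseteq> edges G \<union> arcs G" and cov: "\<And>v. v \<in> verts G \<Longrightarrow> card (?C v) \<le> 1"
    using assms by (auto simp: matching_forest_def)
  have finF: "finite F" using F finite_elements finite_subset by blast
  have heads: "heads G e \<subseteq> verts G" if "e \<in> F" for e
    using that F uends_in_verts head_in_verts by (auto simp: heads_def)
  have "card (uncovered G F) + (\<Sum>v\<in>verts G. card (?C v)) = (\<Sum>v\<in>verts G. 1)"
  proof -
    have "card (uncovered G F) = (\<Sum>v\<in>verts G. if v \<in> uncovered G F then 1 else 0)"
      using finite_verts by (simp add: sum.If_cases uncovered_def Int_def)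
    moreover have "(if v \<in> uncovered G F then 1 else 0) + card (?C v) = 1" if "v \<in> verts G" for v
    proof (cases "v \<in> uncovered G F")
      case True
      then have "?C v = {}" by (auto simp: uncovered_def)
      then show ?thesis using True by (simp only: card.empty if_True add_0_right)
    next
      case False
      then have "?C v \<noteq> {}" using that by (auto simp: uncovered_def)
      then have "card (?C v) > 0" using finF by (simp add: card_gt_0_iff)
      then show ?thesis using cov[OF that] False by simp
    qed
    ultimately show ?thesis by (simp add: sum.distrib[symmetric])
  qed
  moreover have "(\<Sum>v\<in>verts G. card (?C v)) = (\<Sum>e\<in>F. card (heads G e))"
  proof -
    have "(\<Sum>v\<in>verts G. card (?C v)) = (\<Sum>e\<in>F. card {v \<in> verts G. covered_by G v e})"
      using finF finite_verts by (intro sum_multicount_gen) auto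
    also have "\<dots> = (\<Sum>e\<in>F. card (heads G e))"
      by (intro sum.cong refl arg_cong[where f = card]) (use heads in \<open>auto simp: covered_by_def\<close>)
    finally show ?thesis .
  qed
  moreover have "(\<Sum>e\<in>F. card (heads G e)) = 2 * card (F \<inter> edges G) + card (F \<inter> arcs G)"
  proof -
    have split: "F = (F \<inter> edges G) \<union> (F \<inter> arcs G)" using F by blast
    have "(\<Sum>e\<in>F. card (heads G e)) =
        (\<Sum>e\<in>F \<inter> edges G. card (heads G e)) + (\<Sum>e\<in>F \<inter> arcs G. card (heads G e))"
      using finF edges_arcs_disjoint by (subst split, subst sum.union_disjoint) auto
    also have "(\<Sum>e\<in>F \<inter> edges G. card (heads G e)) = (\<Sum>e\<in>F \<inter> edges G. 2)"
      by (rule sum.cong) (auto simp: heads_def edge_no_loop)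
    also have "(\<Sum>e\<in>F \<inter> arcs G. card (heads G e)) = (\<Sum>e\<in>F \<inter> arcs G. 1)"
      by (rule sum.cong) (auto simp: heads_def arc_not_edge)
    finally show ?thesis by simp
  qed
  ultimately show ?thesis by (simp add: mix_size_def)
qed

lemma reachable_from_step:
  "a \<in> arcs G \<Longrightarrow> tail G a \<in> reachable_from G M \<Longrightarrow> head G a \<in> reachable_from G M"
  unfolding reachable_from_def arc_rel_def
  by (auto intro: rtrancl_into_rtrancl)

text \<open>Otherwise each unreachable vertex is covered by an arc of \<open>F\<close>, since the
  edges of \<open>F\<close> lie in \<open>M\<close>. The tail of this arc is unreachable too, so the
  unreachable vertices would carry a cycle of \<open>F\<close>.\<close>

lemma unreachable_uncovered_exists:
  assumes F: "matching_forest G F" and M: "F \<inter> edges G \<subseteq> M"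
    and "\<not> verts G \<subseteq> reachable_from G M"
  shows "\<exists>u. u \<in> uncovered G F - reachable_from G M"
proof (rule ccontr)
  assume contra: "\<not> ?thesis"
  let ?W = "verts G - reachable_from G M"
  have "\<exists>a\<in>F \<inter> arcs G. head G a = w \<and> tail G a \<in> ?W" if w: "w \<in> ?W" for w
  proof -
    obtain e where e: "e \<in> F" "covered_by G w e"
      using contra w by (auto simp: uncovered_def)
    have "e \<notin> edges G"
    proof
      assume "e \<in> edges G"
      then have "w \<in> edge_verts G M"
        using e M by (auto simp: edge_verts_def covered_by_def heads_def)
      then show False using w by (auto simp: reachable_from_def)
    qed
    then have "e \<in> F \<inter> arcs G" "head G e = w"
      using e F by (auto simp: matching_forest_def covered_by_def heads_def)
    then show ?thesis using w tail_in_verts reachable_from_step by blast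
  qed
  then have "\<exists>vs es. underlying_cycle G F vs es"
    using assms(3) finite_verts by (intro underlying_cycle_if_all_entered[of ?W]) auto
  then show False using F by (auto simp: matching_forest_def)
qed

text \<open>Without subtraction, \<open>inv\<close> says that
  \<open>2 * card M - card (edge_verts G M)\<close> is at most the number of uncovered vertices
  already reachable. The cover \<open>H\<close> guarantees an edge from which a given vertex can be
  reached.\<close>

lemma spanning_edges_exist:
  assumes F: "matching_forest G F" and H: "mixed_edge_cover G H"
    and M: "F \<inter> edges G \<subseteq> M" "M \<subseteq> edges G"
    and inv: "2 * card M + card (uncovered G F - reachable_from G M)
      \<le> card (edge_verts G M) + card (uncovered G F)"
  shows "\<exists>M'\<subseteq>edges G. verts G \<subseteq> reachable_from G M' \<and>
    2 * card M' \<le> card (edge_verts G M') + card (uncovered G F)"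
  using M inv
proof (induction "card (uncovered G F - reachable_from G M)" arbitrary: M rule: less_induct)
  case less
  let ?U = "uncovered G F"
  show ?case
  proof (cases "verts G \<subseteq> reachable_from G M")
    case True
    then show ?thesis using less.prems by (intro exI[of _ M]) auto
  next
    case False
    then obtain u where u: "u \<in> ?U" "u \<notin> reachable_from G M"
      using unreachable_uncovered_exists[OF F less.prems(1)] by blast
    then have "u \<in> verts G" by (simp add: uncovered_def)
    then obtain e x where e: "e \<in> edges G" and x: "x \<in> uends G e"
      and xu: "(x, u) \<in> (arc_rel G (H \<inter> arcs G))\<^sup>*"
      using H by (fastforce simp: mixed_edge_cover_iff edge_verts_def)
    have xu': "(x, u) \<in> (arc_rel G (arcs G))\<^sup>*"
      using xu by (rule rtrancl_mono[THEN subsetD, rotated]) (auto simp: arc_rel_def)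
    \<comment> \<open>Otherwise \<open>u\<close> would be reachable from \<open>M\<close>. The new
      edge therefore adds at least one vertex.\<close>
    have x_new: "x \<notin> edge_verts G M"
      using xu' u(2) by (auto simp: reachable_from_def)
    let ?M = "insert e M"
    have mono: "reachable_from G M \<subseteq> reachable_from G ?M"
      by (auto simp: reachable_from_def edge_verts_def)
    have "u \<in> reachable_from G ?M"
      using xu' x by (auto simp: reachable_from_def edge_verts_def)
    then have "?U - reachable_from G ?M \<subset> ?U - reachable_from G M"
      using mono u by blast
    moreover have "finite (?U - reachable_from G M)"
      using finite_verts by (simp add: uncovered_def)
    ultimately have dec: "card (?U - reachable_from G ?M) < card (?U - reachable_from G M)"
      by (rule psubset_card_mono[rotated])
    have M': "?M \<subseteq> edges G" using e less.prems by simp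
    have finV: "finite (edge_verts G ?M)"
      using edge_verts_subset[OF M'] finite_verts finite_subset by blast
    have "edge_verts G M \<subset> edge_verts G ?M" using x x_new by (auto simp: edge_verts_def)
    then have "card (edge_verts G M) < card (edge_verts G ?M)"
      using finV by (rule psubset_card_mono[rotated])
    moreover have "card ?M \<le> Suc (card M)" by (rule card_insert_le_m1) simp_all
    ultimately have "2 * card ?M + card (?U - reachable_from G ?M)
        \<le> card (edge_verts G ?M) + card ?U"
      using dec less.prems(3) by linarith
    then show ?thesis using less.hyps[OF dec] less.prems M' by blast
  qed
qed

lemma matching_forest_edges_disjoint:
  assumes F: "matching_forest G F"
  shows "disjoint_family_on (uends G) (F \<inter> edges G)"
proof -
  have "v \<notin> uends G e \<inter> uends G e'"
    if e: "e \<in> F \<inter> edges G" "e' \<in> F \<inter> edges G" "e \<noteq> e'" for e e' v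
  proof
    assume v: "v \<in> uends G e \<inter> uends G e'"
    then have "v \<in> verts G" using uends_in_verts e by blast
    then have "card {e \<in> F. covered_by G v e} \<le> 1" using F by (simp add: matching_forest_def)
    moreover have "finite {e \<in> F. covered_by G v e}"
      using F finite_elements by (auto simp: matching_forest_def intro: finite_subset)
    moreover have "e \<in> {e \<in> F. covered_by G v e}" "e' \<in> {e \<in> F. covered_by G v e}"
      using v e by (auto simp: covered_by_def heads_def)
    ultimately show False using e(3) by (metis card_le_Suc0_iff_eq One_nat_def)
  qed
  then show ?thesis by (auto simp: disjoint_family_on_def)
qed

lemma mixed_edge_cover_of_matching_forest:
  assumes F: "matching_forest G F" and cover: "mixed_edge_cover G H0"
  shows "\<exists>H. mixed_edge_cover G H \<and> mix_size G F + mix_size G H \<le> card (verts G)"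
proof -
  let ?U = "uncovered G F" and ?N = "F \<inter> edges G"
  have "card (edge_verts G ?N) = 2 * card ?N"
    using matching_forest_edges_disjoint[OF F] by (intro card_edge_verts_matching) auto
  \<comment> \<open>The edges of the forest form a matching, so the invariant holds at the
    start.\<close>
  moreover have "card (?U - reachable_from G ?N) \<le> card ?U"
    using finite_verts by (intro card_mono) (auto simp: uncovered_def)
  ultimately obtain M where M: "M \<subseteq> edges G" "verts G \<subseteq> reachable_from G M"
    and cardM: "2 * card M \<le> card (edge_verts G M) + card ?U"
    using spanning_edges_exist[OF F cover, of ?N] by auto
  let ?S = "edge_verts G M"
  have S: "?S \<subseteq> verts G" using M(1) by (rule edge_verts_subset)
  have "\<And>v. v \<in> verts G \<Longrightarrow> \<exists>u\<in>?S. (u, v) \<in> (arc_rel G (arcs G))\<^sup>*"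
    using M(2) by (auto simp: reachable_from_def)
  then obtain b and rank :: "'v \<Rightarrow> nat" where
    b: "\<forall>v\<in>verts G - ?S. b v \<in> arcs G \<and> head G (b v) = v \<and> rank (tail G (b v)) < rank v"
    by (rule ranked_branching)
  define B where "B = b ` (verts G - ?S)"
  let ?H = "M \<union> B"
  have B: "B \<subseteq> arcs G" using b by (auto simp: B_def)
  have H: "?H \<inter> edges G = M" "?H \<inter> arcs G = B" using M(1) B edges_arcs_disjoint by auto
  \<comment> \<open>Going back along the chosen arcs lowers \<open>rank\<close>, so it ends in
    \<open>?S\<close>.\<close>
  have "\<exists>u\<in>?S. (u, v) \<in> (arc_rel G B)\<^sup>*" if "v \<in> verts G" for v
    using that
  proof (induction "rank v" arbitrary: v rule: less_induct)
    case less
    show ?case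
    proof (cases "v \<in> ?S")
      case False
      then have bv: "b v \<in> B" "head G (b v) = v" "rank (tail G (b v)) < rank v"
        using b less.prems by (auto simp: B_def)
      then obtain u where "u \<in> ?S" "(u, tail G (b v)) \<in> (arc_rel G B)\<^sup>*"
        using less.hyps B tail_in_verts by blast
      moreover have "(tail G (b v), v) \<in> arc_rel G B" using bv by (force simp: arc_rel_def)
      ultimately show ?thesis by (meson rtrancl_into_rtrancl)
    qed auto
  qed
  then have "mixed_edge_cover G ?H"
    unfolding mixed_edge_cover_iff H using M(1) B by blast
  moreover have "mix_size G F + mix_size G ?H \<le> card (verts G)"
  proof -
    \<comment> \<open>Together with \<open>cardM\<close> this bounds
      \<open>2 * card M + card B\<close> by \<open>card (verts G) + card ?U\<close>, which by
      \<open>card_uncovered\<close> is twice \<open>card (verts G) - mix_size G F\<close>.\<close>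
    have "card B \<le> card (verts G - ?S)"
      unfolding B_def using finite_verts by (intro card_image_le) simp
    then have "card B + card ?S \<le> card (verts G)"
      using S finite_verts card_mono[OF finite_verts S] by (simp add: card_Diff_subset finite_subset)
    then show ?thesis
      using card_uncovered[OF F] cardM mix_size_union[OF M(1) B] by simp
  qed
  ultimately show ?thesis by blast
qed

section \<open>Equality of the optima\<close>

lemma matching_forest_empty: "matching_forest G {}"
  by (simp add: matching_forest_def underlying_cycle_def)

lemma finite_mix_sizes:
  assumes "\<And>F. P F \<Longrightarrow> F \<subseteq> edges G \<union> arcs G"
  shows "finite {mix_size G F | F. P F}"
proof (rule finite_subset)
  show "{mix_size G F | F. P F} \<subseteq> mix_size G ` Pow (edges G \<union> arcs G)" using assms by blast
qed (intro finite_imageI finite_Pow_iff[THEN iffD2] finite_elements)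

end

theorem theorem5:
  fixes G :: "('v, 'e) mixed_graph"
  assumes "mixed_graph G"
    and "\<exists>H. mixed_edge_cover G H"
  shows "nu G + rho G = real (card (verts G))"
proof -
  interpret mixed_graph G by fact
  let ?A = "{mix_size G F | F. matching_forest G F}" and ?B = "{mix_size G H | H. mixed_edge_cover G H}"
  have finA: "finite ?A" by (rule finite_mix_sizes) (simp add: matching_forest_def)
  have finB: "finite ?B" by (rule finite_mix_sizes) (simp add: mixed_edge_cover_def)
  have "nu G \<in> ?A" unfolding nu_def using matching_forest_empty by (intro Max_in finA) blast
  then obtain F where F: "matching_forest G F" "nu G = mix_size G F" by blast
  have "rho G \<in> ?B" unfolding rho_def using assms(2) by (intro Min_in finB) blast
  then obtain H where H: "mixed_edge_cover G H" "rho G = mix_size G H" by blast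
  \<comment> \<open>The optimal cover \<open>H\<close> yields the forest \<open>F'\<close> and thus
    \<ge>; the optimal forest \<open>F\<close> yields the cover \<open>H'\<close> and thus
    \<le>.\<close>
  obtain F' where F': "matching_forest G F'" "card (verts G) \<le> mix_size G F' + mix_size G H"
    using matching_forest_of_mixed_edge_cover[OF H(1)] by blast
  obtain H' where H': "mixed_edge_cover G H'" "mix_size G F + mix_size G H' \<le> card (verts G)"
    using mixed_edge_cover_of_matching_forest[OF F(1) H(1)] by blast
  have "mix_size G F' \<le> nu G" unfolding nu_def using F'(1) by (intro Max_ge finA) blast
  moreover have "rho G \<le> mix_size G H'" unfolding rho_def using H'(1) by (intro Min_le finB) blast
  ultimately show ?thesis using F(2) H(2) F'(2) H'(2) by linarith
qed

end
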